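(* Let $x_1,\dots,x_n\in\mathbb{R}^{d+1}$ be points with coordinates $x_i=(1,x_{i1},\dots,x_{id})$, let $\alpha\in(0,1]$ and $h=\lceil\alpha n\rceil$. For every sufficiently large constant $M>0$ (depending on the data), an optimal parameter $\beta^*$ for the least trimmed sum of squares method $LTS(\alpha)$, i.e. a minimizer over $\beta=(\beta_0,\dots,\beta_{d-1})\in\mathbb{R}^d$ of $\sum_{i=1}^{h}\varepsilon_{(i)}(\beta)^2$, where $\varepsilon_i(\beta)=|x_{id}-\sum_{k=1}^{d-1}\beta_kx_{ik}-\beta_0|$, can be obtained by solving the following problem (the $\beta$-component of any optimal solution is such a minimizer), in the variables $\beta\in\mathbb{R}^d$, $z,\theta\in\mathbb{R}^n_+$, $w\in\{0,1\}^{n\times n}$: $$\begin{aligned} \min\ & \sum_{j=1}^{\lceil\alpha n\rceil}\theta_j\\ \text{s.t. } & z_i\le\theta_j+M(1-w_{ij}), && i,j=1,\dots,n,\\ & \textstyle\sum_{i=1}^n w_{ij}=1\ (j=1,\dots,n),\quad \sum_{j=1}^n w_{ij}=1\ (i=1,\dots,n),\\ & \theta_j\ge\theta_{j-1}, && j=2,\dots,n,\\ & z_i\ge\Big(x_{id}-\sum_{k=1}^{d-1}\beta_kx_{ik}-\beta_0\Big)^2, && i=1,\dots,n. \end{aligned}$$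
   Context: Residuals are vertical distances with respect to the last coordinate, with $\beta_d$ normalized to $1$. $\varepsilon_{(1)}(\beta)\le\dots\le\varepsilon_{(n)}(\beta)$ are the residuals $\varepsilon_1(\beta),\dots,\varepsilon_n(\beta)$ sorted in nondecreasing order. $LTS(\alpha)$ minimizes the sum of the squares of the $h=\lceil\alpha n\rceil$ smallest residuals, discarding the rest. *)

theory Defs
  imports Complex_Main "HOL-Library.FuncSet"
begin

text \<open>
  Vectors are functions on \<open>nat\<close> that are extensional on their index set: \<open>\<beta> \<in> {0..<d} \<rightarrow>\<^sub>E UNIV\<close> is
  a vector \<open>(\<beta>\<^sub>0, \<dots>, \<beta>\<^sub>d\<^sub>-\<^sub>1)\<close>, and the points and the variables \<open>z\<close>, \<open>\<theta>\<close>, \<open>w\<close> are indexed from 1 to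
  \<open>n\<close>. The entry \<open>x i k\<close> is coordinate \<open>k \<in> {0..d}\<close> of point \<open>i\<close>.
\<close>

text \<open>The residual before taking the absolute value.\<close>

definition deviation :: "nat \<Rightarrow> (nat \<Rightarrow> nat \<Rightarrow> real) \<Rightarrow> (nat \<Rightarrow> real) \<Rightarrow> nat \<Rightarrow> real" where
  "deviation d x \<beta> i = x i d - (\<Sum>k=1..d - 1. \<beta> k * x i k) - \<beta> 0"

definition residual :: "nat \<Rightarrow> (nat \<Rightarrow> nat \<Rightarrow> real) \<Rightarrow> (nat \<Rightarrow> real) \<Rightarrow> nat \<Rightarrow> real" where
  "residual d x \<beta> i = \<bar>deviation d x \<beta> i\<bar>"

text \<open>The \<open>i\<close>-th smallest residual, for \<open>i \<in> {1..n}\<close>; list positions start at 0.\<close>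

definition sorted_residual ::
    "nat \<Rightarrow> nat \<Rightarrow> (nat \<Rightarrow> nat \<Rightarrow> real) \<Rightarrow> (nat \<Rightarrow> real) \<Rightarrow> nat \<Rightarrow> real" where
  "sorted_residual n d x \<beta> i = sort (map (residual d x \<beta>) [1..<n + 1]) ! (i - 1)"

definition trim_count :: "real \<Rightarrow> nat \<Rightarrow> nat" where
  "trim_count \<alpha> n = nat \<lceil>\<alpha> * real n\<rceil>"

definition lts_objective ::
    "real \<Rightarrow> nat \<Rightarrow> nat \<Rightarrow> (nat \<Rightarrow> nat \<Rightarrow> real) \<Rightarrow> (nat \<Rightarrow> real) \<Rightarrow> real" where
  "lts_objective \<alpha> n d x \<beta> = (\<Sum>i=1..trim_count \<alpha> n. (sorted_residual n d x \<beta> i)\<^sup>2)"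

definition lts_optimal ::
    "real \<Rightarrow> nat \<Rightarrow> nat \<Rightarrow> (nat \<Rightarrow> nat \<Rightarrow> real) \<Rightarrow> (nat \<Rightarrow> real) \<Rightarrow> bool" where
  "lts_optimal \<alpha> n d x \<beta> \<longleftrightarrow>
     is_arg_min (lts_objective \<alpha> n d x) (\<lambda>\<beta>'. \<beta>' \<in> {0..<d} \<rightarrow>\<^sub>E UNIV) \<beta>"

type_synonym mip_point =
  "(nat \<Rightarrow> real) \<times> (nat \<Rightarrow> real) \<times> (nat \<Rightarrow> real) \<times> (nat \<Rightarrow> nat \<Rightarrow> real)"

fun mip_feasible ::
    "real \<Rightarrow> nat \<Rightarrow> nat \<Rightarrow> (nat \<Rightarrow> nat \<Rightarrow> real) \<Rightarrow> mip_point \<Rightarrow> bool" where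
  "mip_feasible M n d x (\<beta>, z, \<theta>, w) \<longleftrightarrow>
     \<beta> \<in> {0..<d} \<rightarrow>\<^sub>E UNIV \<and>
     z \<in> {1..n} \<rightarrow>\<^sub>E {0..} \<and>
     \<theta> \<in> {1..n} \<rightarrow>\<^sub>E {0..} \<and>
     w \<in> {1..n} \<rightarrow>\<^sub>E ({1..n} \<rightarrow>\<^sub>E {0, 1}) \<and>
     (\<forall>i\<in>{1..n}. \<forall>j\<in>{1..n}. z i \<le> \<theta> j + M * (1 - w i j)) \<and>
     (\<forall>j\<in>{1..n}. (\<Sum>i=1..n. w i j) = 1) \<and>
     (\<forall>i\<in>{1..n}. (\<Sum>j=1..n. w i j) = 1) \<and>
     (\<forall>j\<in>{2..n}. \<theta> j \<ge> \<theta> (j - 1)) \<and>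
     (\<forall>i\<in>{1..n}. z i \<ge> (deviation d x \<beta> i)\<^sup>2)"

fun mip_objective :: "real \<Rightarrow> nat \<Rightarrow> mip_point \<Rightarrow> real" where
  "mip_objective \<alpha> n (\<beta>, z, \<theta>, w) = (\<Sum>j=1..trim_count \<alpha> n. \<theta> j)"

definition mip_optimal ::
    "real \<Rightarrow> real \<Rightarrow> nat \<Rightarrow> nat \<Rightarrow> (nat \<Rightarrow> nat \<Rightarrow> real) \<Rightarrow> mip_point \<Rightarrow> bool" where
  "mip_optimal \<alpha> M n d x p \<longleftrightarrow> is_arg_min (mip_objective \<alpha> n) (mip_feasible M n d x) p"

end

theory Submission
  imports Defs "HOL-Library.Multiset"
begin

text \<open>
  For every \<open>M\<close> and every feasible point, the permutation encoded by \<open>w\<close> matches \<open>\<theta>\<^sub>1, \<dots>, \<theta>\<^sub>h\<close> with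
  upper bounds of \<open>h\<close> distinct squared residuals, so the objective is at least the trimmed sum of
  squares of \<open>\<beta>\<close>. Hence it suffices that one minimizer \<open>\<beta>\<^sup>*\<close> of the trimmed sum extends to a feasible
  point of equal value; sorting its residuals gives one as soon as \<open>M\<close> exceeds all its squared
  residuals. Such a \<open>\<beta>\<^sup>*\<close> exists because the trimmed sum is the minimum, over the finitely many
  \<open>h\<close>-element subsets, of ordinary least-squares objectives, each of which attains its minimum.
\<close>

section \<open>Least squares\<close>

text \<open>
  Gram--Schmidt: \<open>r\<close> is the part of the last column orthogonal to the others, and the division by
  zero in \<open>t\<close> for \<open>r = 0\<close> harmlessly yields \<open>t = 0\<close>.
\<close>
lemma normal_equations_solvable:
  fixes a :: "'i \<Rightarrow> nat \<Rightarrow> real" and y :: "'i \<Rightarrow> real"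
  assumes "finite I"
  shows "\<exists>\<beta>. \<forall>l<d. (\<Sum>i\<in>I. (y i - (\<Sum>k<d. \<beta> k * a i k)) * a i l) = 0"
proof (induction d arbitrary: y)
  case 0
  then show ?case by simp
next
  case (Suc d)
  obtain \<beta> where \<beta>: "\<forall>l<d. (\<Sum>i\<in>I. (y i - (\<Sum>k<d. \<beta> k * a i k)) * a i l) = 0"
    using Suc[of y] by blast
  obtain \<gamma> where \<gamma>: "\<forall>l<d. (\<Sum>i\<in>I. (a i d - (\<Sum>k<d. \<gamma> k * a i k)) * a i l) = 0"
    using Suc[of "\<lambda>i. a i d"] by blast
  define e where "e i = y i - (\<Sum>k<d. \<beta> k * a i k)" for i
  define r where "r i = a i d - (\<Sum>k<d. \<gamma> k * a i k)" for i
  define t where "t = (\<Sum>i\<in>I. e i * r i) / (\<Sum>i\<in>I. r i * r i)"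
  \<comment> \<open>Expanding \<open>t * r i\<close> in the columns gives \<open>t\<close> on column
    \<open>d\<close> and \<open>- t * \<gamma> k\<close> on column \<open>k\<close>, so these
    coefficients turn the residual \<open>e\<close> into \<open>e - t * r\<close>.\<close>
  define \<beta>' where "\<beta>' k = (if k = d then t else \<beta> k - t * \<gamma> k)" for k
  have res: "y i - (\<Sum>k<Suc d. \<beta>' k * a i k) = e i - t * r i" for i
    by (simp add: \<beta>'_def e_def r_def algebra_simps sum_subtractf sum_distrib_left)
  have ortho: "(\<Sum>i\<in>I. (e i - t * r i) * a i l) = 0" if "l < d" for l
  proof -
    have "(\<Sum>i\<in>I. (e i - t * r i) * a i l) = (\<Sum>i\<in>I. e i * a i l) - t * (\<Sum>i\<in>I. r i * a i l)"
      by (simp add: algebra_simps sum_subtractf sum_distrib_left)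
    then show ?thesis using \<beta> \<gamma> that by (simp add: e_def r_def)
  qed
  have "(\<Sum>i\<in>I. e i * r i) = t * (\<Sum>i\<in>I. r i * r i)"
  proof (cases "(\<Sum>i\<in>I. r i * r i) = 0")
    case True
    then have "\<forall>i\<in>I. r i = 0"
      using assms by (simp add: sum_nonneg_eq_0_iff)
    then show ?thesis by simp
  next
    case False
    then show ?thesis by (simp add: t_def)
  qed
  then have r: "(\<Sum>i\<in>I. (e i - t * r i) * r i) = 0"
    by (simp add: algebra_simps sum_subtractf sum_distrib_left)
  \<comment> \<open>Column \<open>d\<close> is \<open>r\<close> plus a combination of earlier
    columns, and the new residual is already orthogonal to all of these.\<close>
  have "(\<Sum>i\<in>I. (e i - t * r i) * a i d)
      = (\<Sum>i\<in>I. (e i - t * r i) * r i) + (\<Sum>i\<in>I. \<Sum>k<d. \<gamma> k * ((e i - t * r i) * a i k))"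
    unfolding sum.distrib[symmetric]
  proof (rule sum.cong[OF refl])
    fix i
    have "a i d = r i + (\<Sum>k<d. \<gamma> k * a i k)" by (simp add: r_def)
    then have "(e i - t * r i) * a i d
        = (e i - t * r i) * r i + (e i - t * r i) * (\<Sum>k<d. \<gamma> k * a i k)"
      by (simp only: distrib_left)
    then show "(e i - t * r i) * a i d
        = (e i - t * r i) * r i + (\<Sum>k<d. \<gamma> k * ((e i - t * r i) * a i k))"
      by (simp add: sum_distrib_left mult.left_commute)
  qed
  also have "\<dots> = (\<Sum>k<d. \<gamma> k * (\<Sum>i\<in>I. (e i - t * r i) * a i k))"
    unfolding r by (subst sum.swap) (simp add: sum_distrib_left)
  also have "\<dots> = 0" using ortho by simp
  finally have "\<forall>l<Suc d. (\<Sum>i\<in>I. (e i - t * r i) * a i l) = 0"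
    using ortho less_Suc_eq by auto
  then show ?case by (intro exI[of _ \<beta>']) (simp only: res)
qed

text \<open>Pythagoras: a solution of the normal equations has a residual orthogonal to the span of
  the columns, and any other choice of coefficients changes the residual by a vector of that
  span.\<close>

lemma least_squares_minimizer_exists:
  fixes a :: "'i \<Rightarrow> nat \<Rightarrow> real" and y :: "'i \<Rightarrow> real"
  assumes "finite I"
  shows "\<exists>\<beta>. \<forall>\<beta>'. (\<Sum>i\<in>I. (y i - (\<Sum>k<d. \<beta> k * a i k))\<^sup>2) \<le> (\<Sum>i\<in>I. (y i - (\<Sum>k<d. \<beta>' k * a i k))\<^sup>2)"
proof -
  obtain \<beta> where \<beta>: "\<forall>l<d. (\<Sum>i\<in>I. (y i - (\<Sum>k<d. \<beta> k * a i k)) * a i l) = 0"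
    using normal_equations_solvable[OF assms] by blast
  define e where "e i = y i - (\<Sum>k<d. \<beta> k * a i k)" for i
  have "(\<Sum>i\<in>I. (e i)\<^sup>2) \<le> (\<Sum>i\<in>I. (y i - (\<Sum>k<d. \<beta>' k * a i k))\<^sup>2)" for \<beta>'
  proof -
    define v where "v i = (\<Sum>k<d. (\<beta> k - \<beta>' k) * a i k)" for i
    have "(\<Sum>i\<in>I. e i * v i) = (\<Sum>i\<in>I. \<Sum>k<d. (\<beta> k - \<beta>' k) * (e i * a i k))"
      by (simp add: v_def sum_distrib_left mult.left_commute)
    also have "\<dots> = (\<Sum>k<d. (\<beta> k - \<beta>' k) * (\<Sum>i\<in>I. e i * a i k))"
      by (subst sum.swap) (simp add: sum_distrib_left)
    also have "\<dots> = 0" using \<beta> by (simp add: e_def)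
    finally have ev: "(\<Sum>i\<in>I. e i * v i) = 0" .
    have "(\<Sum>i\<in>I. (y i - (\<Sum>k<d. \<beta>' k * a i k))\<^sup>2) = (\<Sum>i\<in>I. (e i + v i)\<^sup>2)"
      by (simp add: e_def v_def algebra_simps sum_subtractf)
    also have "\<dots> = (\<Sum>i\<in>I. (e i)\<^sup>2) + 2 * (\<Sum>i\<in>I. e i * v i) + (\<Sum>i\<in>I. (v i)\<^sup>2)"
      by (simp add: power2_sum sum.distrib sum_distrib_left mult.assoc)
    finally show ?thesis using ev by (simp add: sum_nonneg)
  qed
  then show ?thesis unfolding e_def by blast
qed

text \<open>The constant coordinate absorbs the intercept as column 0, which puts the problem in the
  homogeneous form used for least squares.\<close>

lemma deviation_eq_linear:
  assumes "d \<ge> 1" and "x i 0 = 1"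
  shows "deviation d x \<beta> i = x i d - (\<Sum>k<d. \<beta> k * x i k)"
proof -
  have "{..<d} = insert 0 {1..d - 1}" using assms(1) by auto
  then show ?thesis using assms(2) by (simp add: deviation_def)
qed

text \<open>Only entries below \<open>d\<close> are read, so a minimizer among all functions can be
  made extensional without changing its value.\<close>

lemma deviation_restrict:
  assumes "d \<ge> 1"
  shows "deviation d x (restrict \<beta> {0..<d}) i = deviation d x \<beta> i"
proof -
  have "(\<Sum>k=1..d - 1. restrict \<beta> {0..<d} k * x i k) = (\<Sum>k=1..d - 1. \<beta> k * x i k)"
    using assms by (intro sum.cong) auto
  then show ?thesis using assms by (simp add: deviation_def)
qed

lemma deviation_least_squares:
  assumes "d \<ge> 1" and "\<And>i. i \<in> I \<Longrightarrow> x i 0 = 1" and "finite I"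
  shows "\<exists>\<beta>\<in>{0..<d} \<rightarrow>\<^sub>E UNIV. \<forall>\<beta>'. (\<Sum>i\<in>I. (deviation d x \<beta> i)\<^sup>2) \<le> (\<Sum>i\<in>I. (deviation d x \<beta>' i)\<^sup>2)"
proof -
  obtain \<beta> where \<beta>: "(\<Sum>i\<in>I. (x i d - (\<Sum>k<d. \<beta> k * x i k))\<^sup>2)
      \<le> (\<Sum>i\<in>I. (x i d - (\<Sum>k<d. \<beta>' k * x i k))\<^sup>2)" for \<beta>'
    using least_squares_minimizer_exists[OF assms(3), where y = "\<lambda>i. x i d" and a = x and d = d]
    by blast
  have "(\<Sum>i\<in>I. (deviation d x \<beta>' i)\<^sup>2) = (\<Sum>i\<in>I. (x i d - (\<Sum>k<d. \<beta>' k * x i k))\<^sup>2)" for \<beta>'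
    using assms by (intro sum.cong) (simp_all add: deviation_eq_linear)
  then show ?thesis
    using \<beta> assms(1) by (intro bexI[of _ "restrict \<beta> {0..<d}"]) (auto simp: deviation_restrict)
qed

section \<open>Sorting and trimming\<close>

lemma sorted_residual_permutation:
  obtains \<pi> where "bij_betw \<pi> {1..n} {1..n}"
    and "\<And>j. j \<in> {1..n} \<Longrightarrow> sorted_residual n d x \<beta> j = residual d x \<beta> (\<pi> j)"
proof -
  define f where "f = residual d x \<beta>"
  \<comment> \<open>Sorting the indices by residual, instead of the residuals themselves, remembers
    which point holds which rank.\<close>
  define s where "s = sort_key f [1..<n + 1]"
  have len: "length s = n" and set: "set s = {1..n}" and dist: "distinct s"
    by (auto simp: s_def)
  have sort: "sort (map f [1..<n + 1]) = map f s"
    by (rule properties_for_sort) (simp_all add: s_def)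
  \<comment> \<open>Ranks start at 1 and list positions at 0.\<close>
  have "bij_betw (\<lambda>j. j - 1) {1..n} {..<n}"
    by (rule bij_betw_byWitness[where f' = Suc]) auto
  moreover have "bij_betw ((!) s) {..<n} {1..n}"
    by (rule bij_betw_nth) (simp_all add: len set dist)
  ultimately have "bij_betw ((!) s \<circ> (\<lambda>j. j - 1)) {1..n} {1..n}"
    by (rule bij_betw_trans)
  moreover have "sorted_residual n d x \<beta> j = residual d x \<beta> (((!) s \<circ> (\<lambda>j. j - 1)) j)"
    if "j \<in> {1..n}" for j
  proof -
    have "j - 1 < length s" using that by (auto simp: len)
    then show ?thesis
      unfolding sorted_residual_def f_def[symmetric] sort by simp
  qed
  ultimately show ?thesis using that by blast
qed

lemma sorted_residual_mono:
  assumes "1 \<le> i" and "i \<le> j" and "j \<le> n"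
  shows "sorted_residual n d x \<beta> i \<le> sorted_residual n d x \<beta> j"
  unfolding sorted_residual_def using assms by (intro sorted_nth_mono) auto

lemma sorted_residual_nonneg:
  assumes "j \<in> {1..n}"
  shows "0 \<le> sorted_residual n d x \<beta> j"
  using assms by (rule_tac sorted_residual_permutation[of n d x \<beta>]) (simp add: residual_def)

text \<open>Exchange argument: \<open>{1..h} - P\<close> and \<open>P - {1..h}\<close> have equally
  many elements, and \<open>g h\<close> bounds \<open>g\<close> from above on the former and from
  below on the latter.\<close>

lemma sum_initial_le_sum_subset:
  fixes g :: "nat \<Rightarrow> real"
  assumes mono: "\<And>i j. 1 \<le> i \<Longrightarrow> i \<le> j \<Longrightarrow> j \<le> n \<Longrightarrow> g i \<le> g j"
    and P: "P \<subseteq> {1..n}" "card P = h"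
  shows "(\<Sum>j=1..h. g j) \<le> (\<Sum>j\<in>P. g j)"
proof -
  have fin: "finite P" using P finite_subset by blast
  have h: "h \<le> n" using P card_mono[of "{1..n}" P] by simp
  have card: "card ({1..h} - P) = card (P - {1..h})"
    using fin P by (intro antisym card_le_sym_Diff) simp_all
  have "(\<Sum>j\<in>{1..h} - P. g j) \<le> card ({1..h} - P) * g h"
    using mono h by (intro sum_bounded_above) auto
  also have "\<dots> \<le> (\<Sum>j\<in>P - {1..h}. g j)"
  \<comment> \<open>Monotonicity says nothing about \<open>g 0\<close>; for \<open>h = 0\<close>
    both sides vanish since \<open>P\<close> is empty.\<close>
  proof (cases "h = 0")
    case True
    then show ?thesis using P fin by simp
  next
    case False
    then show ?thesis unfolding card
      using mono P by (intro sum_bounded_below) force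
  qed
  finally have "(\<Sum>j\<in>{1..h} - P. g j) \<le> (\<Sum>j\<in>P - {1..h}. g j)" .
  moreover have "(\<Sum>j=1..h. g j) = (\<Sum>j\<in>{1..h} \<inter> P. g j) + (\<Sum>j\<in>{1..h} - P. g j)"
    by (rule sum.Int_Diff) simp
  moreover have "(\<Sum>j\<in>P. g j) = (\<Sum>j\<in>P \<inter> {1..h}. g j) + (\<Sum>j\<in>P - {1..h}. g j)"
    using fin by (rule sum.Int_Diff)
  ultimately show ?thesis by (simp add: Int_commute)
qed

lemma trim_count_le:
  assumes "\<alpha> \<le> 1"
  shows "trim_count \<alpha> n \<le> n"
proof -
  have "\<alpha> * real n \<le> real n" using mult_right_mono[OF assms, of "real n"] by simp
  then show ?thesis unfolding trim_count_def by (simp add: nat_le_iff ceiling_le_iff)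
qed

lemma lts_objective_le:
  assumes "S \<subseteq> {1..n}" and "card S = trim_count \<alpha> n"
  shows "lts_objective \<alpha> n d x \<beta> \<le> (\<Sum>i\<in>S. (deviation d x \<beta> i)\<^sup>2)"
proof -
  obtain \<pi> where \<pi>: "bij_betw \<pi> {1..n} {1..n}"
    and sr: "\<And>j. j \<in> {1..n} \<Longrightarrow> sorted_residual n d x \<beta> j = residual d x \<beta> (\<pi> j)"
    using sorted_residual_permutation[of n d x \<beta>] by blast
  \<comment> \<open>The ranks of the points in \<open>S\<close>; comparing them with the first ranks
    reduces the claim to the exchange argument.\<close>
  define P where "P = {j\<in>{1..n}. \<pi> j \<in> S}"
  have PS: "bij_betw \<pi> P S"
  proof (rule bij_betw_subset[OF \<pi>])
    show "P \<subseteq> {1..n}" by (auto simp: P_def)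
    have "S \<subseteq> \<pi> ` {1..n}" using assms(1) bij_betw_imp_surj_on[OF \<pi>] by simp
    then show "\<pi> ` P = S" unfolding P_def by blast
  qed
  have "lts_objective \<alpha> n d x \<beta> \<le> (\<Sum>j\<in>P. (sorted_residual n d x \<beta> j)\<^sup>2)"
    unfolding lts_objective_def
  proof (rule sum_initial_le_sum_subset)
    show "(sorted_residual n d x \<beta> i)\<^sup>2 \<le> (sorted_residual n d x \<beta> j)\<^sup>2"
      if "1 \<le> i" "i \<le> j" "j \<le> n" for i j
      using that by (intro power_mono sorted_residual_mono sorted_residual_nonneg) auto
    show "P \<subseteq> {1..n}" by (auto simp: P_def)
    show "card P = trim_count \<alpha> n" using bij_betw_same_card[OF PS] assms(2) by simp
  qed
  also have "\<dots> = (\<Sum>j\<in>P. (deviation d x \<beta> (\<pi> j))\<^sup>2)"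
    by (intro sum.cong) (auto simp: P_def sr residual_def)
  also have "\<dots> = (\<Sum>i\<in>S. (deviation d x \<beta> i)\<^sup>2)"
    by (rule sum.reindex_bij_betw[OF PS])
  finally show ?thesis .
qed

text \<open>The points of the first \<open>trim_count \<alpha> n\<close> ranks form such a set. With
  the preceding bound, the trimmed sum is a minimum over subsets of that size.\<close>

lemma lts_objective_attained:
  assumes "\<alpha> \<le> 1"
  obtains S where "S \<subseteq> {1..n}" and "card S = trim_count \<alpha> n"
    and "lts_objective \<alpha> n d x \<beta> = (\<Sum>i\<in>S. (deviation d x \<beta> i)\<^sup>2)"
proof -
  obtain \<pi> where \<pi>: "bij_betw \<pi> {1..n} {1..n}"
    and sr: "\<And>j. j \<in> {1..n} \<Longrightarrow> sorted_residual n d x \<beta> j = residual d x \<beta> (\<pi> j)"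
    using sorted_residual_permutation[of n d x \<beta>] by blast
  let ?h = "trim_count \<alpha> n"
  have sub: "{1..?h} \<subseteq> {1..n}" using trim_count_le[OF assms] by simp
  then have bij: "bij_betw \<pi> {1..?h} (\<pi> ` {1..?h})"
    using \<pi> by (intro bij_betw_subset[OF \<pi>]) auto
  have "lts_objective \<alpha> n d x \<beta> = (\<Sum>j=1..?h. (deviation d x \<beta> (\<pi> j))\<^sup>2)"
    unfolding lts_objective_def using sub by (intro sum.cong) (auto simp: sr residual_def)
  also have "\<dots> = (\<Sum>i\<in>\<pi> ` {1..?h}. (deviation d x \<beta> i)\<^sup>2)"
    by (rule sum.reindex_bij_betw[OF bij])
  finally have "lts_objective \<alpha> n d x \<beta> = (\<Sum>i\<in>\<pi> ` {1..?h}. (deviation d x \<beta> i)\<^sup>2)" .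
  moreover have "\<pi> ` {1..?h} \<subseteq> {1..n}"
    using image_mono[OF sub, of \<pi>] bij_betw_imp_surj_on[OF \<pi>] by simp
  moreover have "card (\<pi> ` {1..?h}) = ?h" using bij_betw_same_card[OF bij] by simp
  ultimately show ?thesis using that by blast
qed

lemma lts_optimal_exists:
  assumes "d \<ge> 1" and "\<And>i. i \<in> {1..n} \<Longrightarrow> x i 0 = 1" and "\<alpha> \<le> 1"
  shows "\<exists>\<beta>. lts_optimal \<alpha> n d x \<beta>"
proof -
  let ?F = "{S. S \<subseteq> {1..n} \<and> card S = trim_count \<alpha> n}"
  define c where "c S \<beta> = (\<Sum>i\<in>S. (deviation d x \<beta> i)\<^sup>2)" for S \<beta>
  have "\<forall>S\<in>?F. \<exists>\<beta>. \<beta> \<in> {0..<d} \<rightarrow>\<^sub>E UNIV \<and> (\<forall>\<beta>'. c S \<beta> \<le> c S \<beta>')"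
  proof
    fix S assume S: "S \<in> ?F"
    then have "finite S" using finite_subset by blast
    then show "\<exists>\<beta>. \<beta> \<in> {0..<d} \<rightarrow>\<^sub>E UNIV \<and> (\<forall>\<beta>'. c S \<beta> \<le> c S \<beta>')"
      using deviation_least_squares[of d S x] assms S unfolding c_def by blast
  qed
  from bchoice[OF this] obtain b
    where b: "\<forall>S\<in>?F. b S \<in> {0..<d} \<rightarrow>\<^sub>E UNIV \<and> (\<forall>\<beta>'. c S (b S) \<le> c S \<beta>')" ..
  have fin: "finite ?F" by simp
  have "{1..trim_count \<alpha> n} \<in> ?F" using trim_count_le[OF assms(3)] by simp
  then have ne: "?F \<noteq> {}" by blast
  define T where "T = arg_min_on (\<lambda>S. c S (b S)) ?F"
  have T: "T \<in> ?F"
    unfolding T_def by (rule arg_min_if_finite(1)[OF fin ne])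
  have T_min: "c T (b T) \<le> c S (b S)" if "S \<in> ?F" for S
    unfolding T_def by (rule arg_min_least[OF fin ne that])
  \<comment> \<open>Two minimizations combine: a competitor attains its trimmed sum on some
    \<open>S\<close>, where it is no better than \<open>b S\<close>, and \<open>T\<close> was chosen
    as the best subset.\<close>
  have "lts_objective \<alpha> n d x (b T) \<le> lts_objective \<alpha> n d x \<beta>'" for \<beta>'
  proof -
    obtain S where S: "S \<in> ?F" "lts_objective \<alpha> n d x \<beta>' = c S \<beta>'"
      using lts_objective_attained[OF assms(3), of n d x \<beta>'] unfolding c_def by auto
    have "lts_objective \<alpha> n d x (b T) \<le> c T (b T)"
      using T lts_objective_le[of T n \<alpha> d x "b T"] unfolding c_def by simp
    also have "\<dots> \<le> c S (b S)" using S(1) by (rule T_min)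
    also have "\<dots> \<le> c S \<beta>'" using b S(1) by blast
    finally show ?thesis using S(2) by simp
  qed
  then show ?thesis
    using b T unfolding lts_optimal_def is_arg_min_linorder by blast
qed

section \<open>The mixed-integer program\<close>

text \<open>The sum counts the ones. This reads a permutation off the row and column constraints on
  \<open>w\<close>.\<close>

lemma binary_sum_eq_1:
  fixes f :: "'a \<Rightarrow> real"
  assumes "finite A" and "\<And>a. a \<in> A \<Longrightarrow> f a \<in> {0, 1}" and "sum f A = 1"
  shows "\<exists>!a. a \<in> A \<and> f a = 1"
proof -
  have "sum f A = (\<Sum>a\<in>A. if f a = 1 then 1 else 0)"
    using assms(2) by (intro sum.cong) auto
  also have "\<dots> = real (card {a\<in>A. f a = 1})"
    using assms(1) by (simp add: sum.If_cases Collect_conj_eq)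
  finally have "card {a\<in>A. f a = 1} = 1" using assms(3) by simp
  then obtain a where "{a\<in>A. f a = 1} = {a}" by (auto simp: card_1_singleton_iff)
  then show ?thesis by (intro ex1I[of _ a]) auto
qed

lemma lts_objective_le_mip_objective:
  assumes feas: "mip_feasible M n d x (\<beta>, z, \<theta>, w)" and "\<alpha> \<le> 1"
  shows "lts_objective \<alpha> n d x \<beta> \<le> mip_objective \<alpha> n (\<beta>, z, \<theta>, w)"
proof -
  let ?h = "trim_count \<alpha> n"
  have link: "\<forall>i\<in>{1..n}. \<forall>j\<in>{1..n}. z i \<le> \<theta> j + M * (1 - w i j)"
    using feas by simp
  have w01: "w i j \<in> {0, 1}" if "i \<in> {1..n}" "j \<in> {1..n}" for i j
    using feas that by (auto simp: PiE_iff)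
  have "\<forall>j\<in>{1..n}. \<exists>!i. i \<in> {1..n} \<and> w i j = 1"
    using feas w01 by (intro ballI binary_sum_eq_1) auto
  then obtain \<sigma> where \<sigma>: "\<And>j. j \<in> {1..n} \<Longrightarrow> \<sigma> j \<in> {1..n} \<and> w (\<sigma> j) j = 1"
    by metis
  have row: "\<exists>!j. j \<in> {1..n} \<and> w i j = 1" if "i \<in> {1..n}" for i
    using feas w01 that by (intro binary_sum_eq_1) auto
  \<comment> \<open>Two columns sharing a row would put two ones into that row.\<close>
  have inj: "inj_on \<sigma> {1..n}"
    using \<sigma> row by (intro inj_onI) metis
  have sub: "{1..?h} \<subseteq> {1..n}" using trim_count_le[OF assms(2)] by simp
  have inj': "inj_on \<sigma> {1..?h}" using inj sub by (rule inj_on_subset)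
  have "lts_objective \<alpha> n d x \<beta> \<le> (\<Sum>i\<in>\<sigma> ` {1..?h}. (deviation d x \<beta> i)\<^sup>2)"
    using \<sigma> sub card_image[OF inj'] by (intro lts_objective_le) auto
  also have "\<dots> = (\<Sum>j=1..?h. (deviation d x \<beta> (\<sigma> j))\<^sup>2)"
    by (simp only: sum.reindex[OF inj'] o_def)
  also have "\<dots> \<le> (\<Sum>j=1..?h. \<theta> j)"
  proof (rule sum_mono)
    fix j assume "j \<in> {1..?h}"
    then have j: "j \<in> {1..n}" using sub by blast
    \<comment> \<open>At the entry \<open>w (\<sigma> j) j = 1\<close> the term with
      \<open>M\<close> vanishes, so the bound holds whatever \<open>M\<close> is.\<close>
    have "(deviation d x \<beta> (\<sigma> j))\<^sup>2 \<le> z (\<sigma> j)" using feas \<sigma>[OF j] by simp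
    also have "\<dots> \<le> \<theta> j + M * (1 - w (\<sigma> j) j)" using link \<sigma>[OF j] j by blast
    finally show "(deviation d x \<beta> (\<sigma> j))\<^sup>2 \<le> \<theta> j" using \<sigma>[OF j] by simp
  qed
  finally show ?thesis by simp
qed

lemma mip_feasible_extension:
  assumes \<beta>: "\<beta> \<in> {0..<d} \<rightarrow>\<^sub>E UNIV"
    and M: "\<And>i. i \<in> {1..n} \<Longrightarrow> (deviation d x \<beta> i)\<^sup>2 \<le> M"
    and "\<alpha> \<le> 1"
  obtains z \<theta> w where "mip_feasible M n d x (\<beta>, z, \<theta>, w)"
    and "mip_objective \<alpha> n (\<beta>, z, \<theta>, w) = lts_objective \<alpha> n d x \<beta>"
proof -
  obtain \<pi> where \<pi>: "bij_betw \<pi> {1..n} {1..n}"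
    and sr: "\<And>j. j \<in> {1..n} \<Longrightarrow> sorted_residual n d x \<beta> j = residual d x \<beta> (\<pi> j)"
    using sorted_residual_permutation[of n d x \<beta>] by blast
  define z where "z = (\<lambda>i\<in>{1..n}. (deviation d x \<beta> i)\<^sup>2)"
  define \<theta> where "\<theta> = (\<lambda>j\<in>{1..n}. (sorted_residual n d x \<beta> j)\<^sup>2)"
  define w :: "nat \<Rightarrow> nat \<Rightarrow> real"
    where "w = (\<lambda>i\<in>{1..n}. \<lambda>j\<in>{1..n}. if \<pi> j = i then 1 else 0)"
  \<comment> \<open>If \<open>\<pi> j = i\<close>, then \<open>z i = \<theta> j\<close>; otherwise
    \<open>M\<close> alone bounds \<open>z i\<close> and \<open>\<theta> j\<close> is
    nonnegative.\<close>
  have "z i \<le> \<theta> j + M * (1 - w i j)" if "i \<in> {1..n}" "j \<in> {1..n}" for i j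
    using M[OF that(1)] that sr[OF that(2)]
    by (auto simp: z_def \<theta>_def w_def residual_def intro: add_increasing)
  moreover have "(\<Sum>i=1..n. w i j) = 1" if "j \<in> {1..n}" for j
  proof -
    have "\<pi> j \<in> {1..n}" using \<pi> that by (auto simp: bij_betw_def)
    moreover have "(\<Sum>i=1..n. w i j) = (\<Sum>i=1..n. if \<pi> j = i then 1 else 0)"
      using that by (intro sum.cong) (auto simp: w_def)
    ultimately show ?thesis by simp
  qed
  moreover have "(\<Sum>j=1..n. w i j) = 1" if "i \<in> {1..n}" for i
  proof -
    \<comment> \<open>Reindexing along \<open>\<pi>\<close> shows that exactly one rank is assigned
      to point \<open>i\<close>.\<close>
    have "(\<Sum>j=1..n. w i j) = (\<Sum>j=1..n. (\<lambda>k. if k = i then 1 else 0) (\<pi> j))"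
      using that by (intro sum.cong) (auto simp: w_def)
    also have "\<dots> = (\<Sum>k=1..n. if k = i then 1 else 0)"
      by (rule sum.reindex_bij_betw[OF \<pi>])
    finally show ?thesis using that by simp
  qed
  moreover have "\<theta> (j - 1) \<le> \<theta> j" if "j \<in> {2..n}" for j
  proof -
    have "j \<in> {1..n}" "j - 1 \<in> {1..n}" using that by auto
    then show ?thesis
      using sorted_residual_nonneg sorted_residual_mono by (auto simp: \<theta>_def intro!: power_mono)
  qed
  ultimately have "mip_feasible M n d x (\<beta>, z, \<theta>, w)"
    using \<beta> by (simp add: z_def \<theta>_def w_def)
  moreover have "mip_objective \<alpha> n (\<beta>, z, \<theta>, w) = lts_objective \<alpha> n d x \<beta>"
    unfolding lts_objective_def mip_objective.simps
    using trim_count_le[OF assms(3), of n] by (intro sum.cong) (auto simp: \<theta>_def)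
  ultimately show ?thesis using that by blast
qed

theorem theorem14:
  fixes n d :: nat and x :: "nat \<Rightarrow> nat \<Rightarrow> real" and \<alpha> :: real
  assumes "n \<ge> 1" and "d \<ge> 1"
    and "\<And>i. i \<in> {1..n} \<Longrightarrow> x i 0 = 1"
    and "0 < \<alpha>" and "\<alpha> \<le> 1"
  shows "\<exists>M\<^sub>0>0. \<forall>M\<ge>M\<^sub>0.
           (\<exists>p. mip_optimal \<alpha> M n d x p) \<and>
           (\<forall>\<beta> z \<theta> w. mip_optimal \<alpha> M n d x (\<beta>, z, \<theta>, w) \<longrightarrow> lts_optimal \<alpha> n d x \<beta>)"
proof -
  obtain b where "lts_optimal \<alpha> n d x b"
    using lts_optimal_exists assms by blast
  then have b: "b \<in> {0..<d} \<rightarrow>\<^sub>E UNIV"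
    and b_min: "\<And>\<beta>. \<beta> \<in> {0..<d} \<rightarrow>\<^sub>E UNIV \<Longrightarrow> lts_objective \<alpha> n d x b \<le> lts_objective \<alpha> n d x \<beta>"
    unfolding lts_optimal_def is_arg_min_linorder by blast+
  \<comment> \<open>The sum dominates each squared residual of the fixed minimizer \<open>b\<close>;
    adding 1 makes the constant positive.\<close>
  define M\<^sub>0 where "M\<^sub>0 = 1 + (\<Sum>i=1..n. (deviation d x b i)\<^sup>2)"
  have "M\<^sub>0 > 0" by (simp add: M\<^sub>0_def add_pos_nonneg sum_nonneg)
  moreover have "(\<exists>p. mip_optimal \<alpha> M n d x p) \<and>
      (\<forall>\<beta> z \<theta> w. mip_optimal \<alpha> M n d x (\<beta>, z, \<theta>, w) \<longrightarrow> lts_optimal \<alpha> n d x \<beta>)"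
    if "M \<ge> M\<^sub>0" for M
  proof -
    have "(deviation d x b i)\<^sup>2 \<le> M" if "i \<in> {1..n}" for i
      using member_le_sum[OF that, of "\<lambda>i. (deviation d x b i)\<^sup>2"] \<open>M \<ge> M\<^sub>0\<close>
      by (simp add: M\<^sub>0_def)
    then obtain z \<theta> w where feas: "mip_feasible M n d x (b, z, \<theta>, w)"
      and val: "mip_objective \<alpha> n (b, z, \<theta>, w) = lts_objective \<alpha> n d x b"
      using mip_feasible_extension[OF b] assms(5) by blast
    have "mip_objective \<alpha> n (b, z, \<theta>, w) \<le> mip_objective \<alpha> n q" if "mip_feasible M n d x q" for q
    proof -
      obtain \<beta>' z' \<theta>' w' where q: "q = (\<beta>', z', \<theta>', w')" by (cases q)
      have "lts_objective \<alpha> n d x b \<le> lts_objective \<alpha> n d x \<beta>'"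
        using b_min that unfolding q by simp
      also have "\<dots> \<le> mip_objective \<alpha> n q"
        using lts_objective_le_mip_objective assms(5) that unfolding q by blast
      finally show ?thesis using val by simp
    qed
    then have "mip_optimal \<alpha> M n d x (b, z, \<theta>, w)"
      using feas unfolding mip_optimal_def is_arg_min_linorder by blast
    \<comment> \<open>Sandwich: the trimmed sum of \<open>\<beta>'\<close> is at most its program
      value, which by optimality is at most the value at the extension of \<open>b\<close>, that is,
      the minimal trimmed sum.\<close>
    moreover have "lts_optimal \<alpha> n d x \<beta>'" if "mip_optimal \<alpha> M n d x (\<beta>', z', \<theta>', w')" for \<beta>' z' \<theta>' w'
    proof -
      have feas': "mip_feasible M n d x (\<beta>', z', \<theta>', w')"
        and "mip_objective \<alpha> n (\<beta>', z', \<theta>', w') \<le> mip_objective \<alpha> n (b, z, \<theta>, w)"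
        using that feas unfolding mip_optimal_def is_arg_min_linorder by blast+
      then have "lts_objective \<alpha> n d x \<beta>' \<le> lts_objective \<alpha> n d x b"
        using lts_objective_le_mip_objective[OF feas' assms(5)] val by simp
      moreover have "\<beta>' \<in> {0..<d} \<rightarrow>\<^sub>E UNIV" using feas' by simp
      ultimately show ?thesis
        using b_min order_trans unfolding lts_optimal_def is_arg_min_linorder by blast
    qed
    ultimately show ?thesis by blast
  qed
  ultimately show ?thesis by blast
qed

end
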